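(* Let $X$ be a $k$-dimensional random vector on a probability space $(\Omega,\Sigma,P)$, and let $X_1,X_2,\ldots$ be an (infinite) random sample from $X$, with each $X_i$ defined on $(\Omega,\Sigma,P)$. Let $E=\{X_1,X_2,\ldots\}$ (the random subset $E(\omega)=\{X_1(\omega),X_2(\omega),\ldots\}$ of $\mathbb{R}^k$), and let $\overline{E}$ be the closure of $E$ in the Euclidean topology of $\mathbb{R}^k$. Then $\overline{E}=H(X)$ almost surely, i.e. for $P$-almost every $\omega\in\Omega$ one has $\overline{E(\omega)}=H(X)$.
   Context: A $k$-dimensional random vector is a map $X:\Omega\to\mathbb{R}^k$ that is measurable with respect to the Borel sigma-algebra on $\mathbb{R}^k$. A random sample $X_1,X_2,\ldots$ from $X$ is an infinite sequence of independent random vectors, each having the same distribution as $X$. A point $x\in\mathbb{R}^k$ is called a heavy point of (the distribution of) $X$ if $P(X\in U)>0$ for every open set $U\subset\mathbb{R}^k$ containing $x$. The set of all heavy points is denoted $H(X)$; it depends only on the distribution of $X$. *)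

theory Defs
  imports "HOL-Probability.Probability"
begin

definition heavy_points :: "'w measure \<Rightarrow> ('w \<Rightarrow> real ^ 'k) \<Rightarrow> (real ^ 'k) set" where
  "heavy_points M X =
     {x. \<forall>U. open U \<longrightarrow> x \<in> U \<longrightarrow> measure M {\<omega> \<in> space M. X \<omega> \<in> U} > 0}"

text \<open>The sample is indexed from 0, so \<open>Xs i\<close> stands for the vector usually written with
  index \<open>i + 1\<close>. Measurability of each \<open>Xs i\<close> is part of \<open>prob_space.indep_vars\<close>.\<close>

definition random_sample :: "'w measure \<Rightarrow> ('w \<Rightarrow> real ^ 'k) \<Rightarrow> (nat \<Rightarrow> 'w \<Rightarrow> real ^ 'k) \<Rightarrow> bool" where
  "random_sample M X Xs \<longleftrightarrow>
     prob_space.indep_vars M (\<lambda>_. borel) Xs UNIV \<and>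
     (\<forall>i. distr M borel (Xs i) = distr M borel X)"

end

theory Submission
  imports Defs
begin

text \<open>Both sides of the claimed equality are determined by the open sets that they see. A point
  lies in the closure of the sample iff every open \<open>U\<close> around it is \<^emph>\<open>hit\<close> by the sample,
  and it is heavy iff every open \<open>U\<close> around it is \<^emph>\<open>charged\<close>, that is, \<open>P (X \<in> U) > 0\<close>.
  So it suffices that almost surely the open sets that are hit are those that are charged.

  For one Borel set \<open>U\<close> this is a zero-one statement (\<open>AE_hit_iff_charged\<close>): the sample misses
  \<open>U\<close> during its first \<open>n\<close> draws with probability \<open>(1 - P (X \<in> U)) ^ n\<close>, which tends to 0 if
  \<open>U\<close> is charged; if it is not, then hitting \<open>U\<close> is a countable union of null events.
  The exceptional null set depends on \<open>U\<close>, and uncountably many null sets need not have a null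
  union, so the zero-one statement is applied only to the members of a countable base; these
  suffice to test both closure and heaviness (\<open>closure_eq_heavy_points\<close>).\<close>

context prob_space
begin

lemma prob_miss_initial_segment:
  fixes Xs :: "nat \<Rightarrow> 'a \<Rightarrow> 'b"
  assumes indep: "indep_vars (\<lambda>_. N) Xs UNIV"
    and A: "A \<in> sets N"
    and p: "\<And>i. prob {\<omega> \<in> space M. Xs i \<omega> \<in> A} = p"
  shows "prob {\<omega> \<in> space M. \<forall>i<n. Xs i \<omega> \<notin> A} = (1 - p) ^ n"
proof (cases "n = 0")
  case True
  then show ?thesis by (simp add: prob_space)
next
  case False
  have meas: "Xs i \<in> measurable M N" for i
    using indep by (auto simp: indep_vars_def)
  have miss: "prob (Xs i -` (space N - A) \<inter> space M) = 1 - p" for i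
  proof -
    have "Xs i -` (space N - A) \<inter> space M = space M - {\<omega> \<in> space M. Xs i \<omega> \<in> A}"
      using measurable_space[OF meas] by auto
    moreover have "{\<omega> \<in> space M. Xs i \<omega> \<in> A} \<in> events"
      using meas A by measurable
    ultimately show ?thesis
      by (simp add: prob_compl p)
  qed
  have "{\<omega> \<in> space M. \<forall>i<n. Xs i \<omega> \<notin> A} = (\<Inter>i\<in>{..<n}. Xs i -` (space N - A) \<inter> space M)"
    using False measurable_space[OF meas] by auto
  also have "prob \<dots> = (\<Prod>i<n. prob (Xs i -` (space N - A) \<inter> space M))"
    using False A by (intro indep_varsD[OF indep]) auto
  finally show ?thesis
    by (simp add: miss)
qed

lemma AE_hit_iff_charged:
  fixes Xs :: "nat \<Rightarrow> 'a \<Rightarrow> 'b"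
  assumes indep: "indep_vars (\<lambda>_. N) Xs UNIV"
    and A: "A \<in> sets N"
    and p: "\<And>i. prob {\<omega> \<in> space M. Xs i \<omega> \<in> A} = p"
  shows "AE \<omega> in M. (\<exists>i. Xs i \<omega> \<in> A) \<longleftrightarrow> p > 0"
proof (cases "p > 0")
  case True
  have [measurable]: "Xs i \<in> measurable M N" for i
    using indep by (auto simp: indep_vars_def)
  note [measurable] = A
  have "p \<le> 1"
    using prob_le_1 p by metis
  let ?never = "{\<omega> \<in> space M. \<forall>i. Xs i \<omega> \<notin> A}"
  have "prob ?never \<le> (1 - p) ^ n" for n
  proof -
    have "prob ?never \<le> prob {\<omega> \<in> space M. \<forall>i<n. Xs i \<omega> \<notin> A}"
      by (rule finite_measure_mono) (auto intro: measurable)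
    then show ?thesis
      by (simp add: prob_miss_initial_segment[OF indep A p])
  qed
  moreover have "(\<lambda>n. (1 - p) ^ n) \<longlonglongrightarrow> 0"
    using True \<open>p \<le> 1\<close> by (intro LIMSEQ_realpow_zero) auto
  ultimately have "prob ?never \<le> 0"
    by (intro LIMSEQ_le_const) auto
  then have "prob ?never = 0"
    by (simp add: measure_le_0_iff)
  then have "AE \<omega> in M. \<exists>i. Xs i \<omega> \<in> A"
    by (subst (asm) prob_eq_0) (auto elim!: eventually_mono)
  with True show ?thesis by simp
next
  case False
  have [measurable]: "Xs i \<in> measurable M N" for i
    using indep by (auto simp: indep_vars_def)
  note [measurable] = A
  have "AE \<omega> in M. Xs i \<omega> \<notin> A" for i
  proof -
    have "prob {\<omega> \<in> space M. Xs i \<omega> \<in> A} = 0"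
      using False p[of i] measure_nonneg[of M "{\<omega> \<in> space M. Xs i \<omega> \<in> A}"] by linarith
    then show ?thesis
      by (subst (asm) prob_eq_0) (auto elim!: eventually_mono)
  qed
  then have "AE \<omega> in M. \<forall>i. Xs i \<omega> \<notin> A"
    by (simp add: AE_all_countable)
  with False show ?thesis by simp
qed

end

text \<open>A base suffices because both properties pass from a basic set \<open>B\<close> with \<open>x \<in> B \<subseteq> U\<close> to \<open>U\<close>:
  if \<open>B\<close> is hit, so is \<open>U\<close>, and if \<open>B\<close> is charged, so is \<open>U\<close>.\<close>

lemma closure_eq_heavy_points:
  fixes X :: "'w \<Rightarrow> real ^ 'k"
  assumes "finite_measure M" and [measurable]: "X \<in> borel_measurable M"
    and base: "topological_basis \<B>"
    and hit: "\<And>B. B \<in> \<B> \<Longrightarrow> S \<inter> B \<noteq> {} \<longleftrightarrow> measure M {\<omega> \<in> space M. X \<omega> \<in> B} > 0"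
  shows "closure S = heavy_points M X"
proof (rule set_eqI)
  interpret finite_measure M by fact
  fix x
  let ?\<B>x = "{B \<in> \<B>. x \<in> B}"
  have "x \<in> closure S \<longleftrightarrow> (\<forall>B\<in>?\<B>x. S \<inter> B \<noteq> {})"
  proof
    assume "x \<in> closure S"
    then show "\<forall>B\<in>?\<B>x. S \<inter> B \<noteq> {}"
      using topological_basis_open[OF base] open_Int_closure_eq_empty[of _ S] by blast
  next
    assume basic: "\<forall>B\<in>?\<B>x. S \<inter> B \<noteq> {}"
    show "x \<in> closure S"
    proof (rule ccontr)
      assume "x \<notin> closure S"
      then have "open (- closure S)" "x \<in> - closure S"
        by auto
      then obtain B where "B \<in> \<B>" "x \<in> B" "B \<subseteq> - closure S"
        using topological_basisE[OF base] by metis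
      with basic show False
        using closure_subset[of S] by blast
    qed
  qed
  also have "\<dots> \<longleftrightarrow> (\<forall>B\<in>?\<B>x. measure M {\<omega> \<in> space M. X \<omega> \<in> B} > 0)"
    using hit by simp
  also have "\<dots> \<longleftrightarrow> x \<in> heavy_points M X"
  proof
    assume charged: "\<forall>B\<in>?\<B>x. measure M {\<omega> \<in> space M. X \<omega> \<in> B} > 0"
    show "x \<in> heavy_points M X"
      unfolding heavy_points_def
    proof (intro CollectI allI impI)
      fix U :: "(real ^ 'k) set"
      assume "open U" "x \<in> U"
      then obtain B where B: "B \<in> \<B>" "x \<in> B" "B \<subseteq> U"
        using topological_basisE[OF base] by metis
      have [measurable]: "U \<in> sets borel"
        using \<open>open U\<close> by simp
      have "0 < measure M {\<omega> \<in> space M. X \<omega> \<in> B}"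
        using charged B by simp
      also have "\<dots> \<le> measure M {\<omega> \<in> space M. X \<omega> \<in> U}"
        using B by (intro finite_measure_mono) auto
      finally show "0 < measure M {\<omega> \<in> space M. X \<omega> \<in> U}" .
    qed
  next
    assume "x \<in> heavy_points M X"
    then show "\<forall>B\<in>?\<B>x. measure M {\<omega> \<in> space M. X \<omega> \<in> B} > 0"
      using topological_basis_open[OF base] by (auto simp: heavy_points_def)
  qed
  finally show "x \<in> closure S \<longleftrightarrow> x \<in> heavy_points M X" .
qed

theorem theorem2p1:
  fixes M :: "'w measure"
    and X :: "'w \<Rightarrow> real ^ 'k"
    and Xs :: "nat \<Rightarrow> 'w \<Rightarrow> real ^ 'k"
  assumes "prob_space M"
    and "X \<in> borel_measurable M"
    and "random_sample M X Xs"
  shows "AE \<omega> in M. closure (range (\<lambda>i. Xs i \<omega>)) = heavy_points M X"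
proof -
  interpret prob_space M by fact
  have indep: "indep_vars (\<lambda>_. borel) Xs UNIV"
    and distr: "\<And>i. distr M borel (Xs i) = distr M borel X"
    using assms(3) by (auto simp: random_sample_def)
  have meas: "Xs i \<in> borel_measurable M" for i
    using indep by (auto simp: indep_vars_def)
  have same: "prob {\<omega> \<in> space M. Xs i \<omega> \<in> B} = prob {\<omega> \<in> space M. X \<omega> \<in> B}"
    if "B \<in> sets borel" for i B
  proof -
    have "measure (distr M borel (Xs i)) B = measure (distr M borel X) B"
      by (simp add: distr)
    then show ?thesis
      using that meas assms(2) by (simp add: measure_distr vimage_def Int_def conj_commute)
  qed
  obtain \<B> :: "(real ^ 'k) set set" where \<B>: "countable \<B>" "topological_basis \<B>"
    using ex_countable_basis by blast
  have "AE \<omega> in M. (\<exists>i. Xs i \<omega> \<in> B) \<longleftrightarrow> prob {\<omega> \<in> space M. X \<omega> \<in> B} > 0" if "B \<in> \<B>" for B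
  proof -
    have "B \<in> sets borel"
      using topological_basis_open[OF \<B>(2) that] by simp
    then show ?thesis
      using AE_hit_iff_charged[OF indep] same by blast
  qed
  then have "AE \<omega> in M. \<forall>B\<in>\<B>. (\<exists>i. Xs i \<omega> \<in> B) \<longleftrightarrow> prob {\<omega> \<in> space M. X \<omega> \<in> B} > 0"
    using \<B>(1) by (simp add: AE_ball_countable)
  then show ?thesis
  proof (rule AE_mp, intro AE_I2 impI)
    fix \<omega>
    assume "\<forall>B\<in>\<B>. (\<exists>i. Xs i \<omega> \<in> B) \<longleftrightarrow> prob {\<omega> \<in> space M. X \<omega> \<in> B} > 0"
    then have "range (\<lambda>i. Xs i \<omega>) \<inter> B \<noteq> {} \<longleftrightarrow> prob {\<omega> \<in> space M. X \<omega> \<in> B} > 0" if "B \<in> \<B>" for B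
      using that by blast
    then show "closure (range (\<lambda>i. Xs i \<omega>)) = heavy_points M X"
      by (intro closure_eq_heavy_points[OF finite_measure_axioms assms(2) \<B>(2)])
  qed
qed

end
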